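(* Let $G=(V,E,w)$ be a finite, undirected, connected graph with positive edge weights, let $s_1,s_2\in V$ be distinct seeds and $q\in V$. Let $x_q^{\mathrm{PW}}$ be the Power Watershed potential of $q$ for seed $s_1$ with $\beta=2$, and let $w_{\max}=\max_{f\in\mathcal{F}_{s_1}^{s_2}}w(f)$. Then $$x_q^{\mathrm{PW}}=\frac{\left|\{f\in\mathcal{F}_{s_1,q}^{s_2} : w(f)=w_{\max}\}\right|}{\left|\{f\in\mathcal{F}_{s_1}^{s_2} : w(f)=w_{\max}\}\right|}.$$
   Context: The weight of a forest is the product of the weights of its edges. $\mathcal{F}_{s_1}^{s_2}$ is the set of spanning forests of $G$ with exactly two trees in which $s_1$ and $s_2$ lie in different trees, and $\mathcal{F}_{s_1,q}^{s_2}$ is the subset of those in which $q$ lies in the same tree as $s_1$. For $\alpha>0$, let $x^{(\alpha)}$ be the minimizer of $\sum_{e=\{u,v\}\in E}w(e)^{\alpha}(x_u-x_v)^2$ subject to $x_{s_1}=1$, $x_{s_2}=0$ (the Random Walker potentials for weights $w^\alpha$). The Power Watershed potential with $\beta=2$ (Couprie et al.) is $x_q^{\mathrm{PW}}=\lim_{\alpha\to\infty}x^{(\alpha)}_q$; it is the output of the Power Watershed algorithm, a Kruskal-like maximum-weight spanning forest construction rooted at the seeds which, on each plateau (maximal connected subgraph of constant edge weight), solves $\min_x\sum_{\{u,v\}}(x_u-x_v)^2$ on that plateau. *)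

theory Defs
  imports "HOL-Analysis.Analysis"
begin

definition adj_rel :: "'a set set \<Rightarrow> ('a \<times> 'a) set" where
  "adj_rel E = {(u, v). u \<noteq> v \<and> {u, v} \<in> E}"

definition conn_rel :: "'a set \<Rightarrow> 'a set set \<Rightarrow> ('a \<times> 'a) set" where
  "conn_rel V E = {(u, v). u \<in> V \<and> v \<in> V \<and> (u, v) \<in> (adj_rel E)\<^sup>*}"

definition connected_graph :: "'a set \<Rightarrow> 'a set set \<Rightarrow> bool" where
  "connected_graph V E \<longleftrightarrow> V \<noteq> {} \<and> (\<forall>u\<in>V. \<forall>v\<in>V. (u, v) \<in> conn_rel V E)"

definition conn_components :: "'a set \<Rightarrow> 'a set set \<Rightarrow> 'a set set" where
  "conn_components V E = V // conn_rel V E"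

definition is_cycle :: "'a set set \<Rightarrow> 'a list \<Rightarrow> bool" where
  "is_cycle E p \<longleftrightarrow> 3 \<le> length p \<and> distinct p \<and>
     (\<forall>i<length p. {p ! i, p ! (Suc i mod length p)} \<in> E)"

text \<open>A finite weighted simple graph: an edge is the two-element set of its end points.\<close>

locale weighted_graph =
  fixes V :: "'a set" and E :: "'a set set" and w :: "'a set \<Rightarrow> real"
  assumes finite_V: "finite V"
    and edges: "\<And>e. e \<in> E \<Longrightarrow> e \<subseteq> V \<and> card e = 2"
    and w_pos: "\<And>e. e \<in> E \<Longrightarrow> 0 < w e"

text \<open>A spanning forest has vertex set \<open>V\<close>, so it is represented by its edge set; isolated
  vertices count as trees.\<close>

definition spanning_forest :: "'a set set \<Rightarrow> 'a set set \<Rightarrow> bool" where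
  "spanning_forest E F \<longleftrightarrow> F \<subseteq> E \<and> (\<nexists>p. is_cycle F p)"

definition forest_weight :: "('a set \<Rightarrow> real) \<Rightarrow> 'a set set \<Rightarrow> real" where
  "forest_weight w F = (\<Prod>e\<in>F. w e)"

definition separating_forests :: "'a set \<Rightarrow> 'a set set \<Rightarrow> 'a \<Rightarrow> 'a \<Rightarrow> 'a set set set" where
  "separating_forests V E s1 s2 =
     {F. spanning_forest E F \<and> card (conn_components V F) = 2 \<and> (s1, s2) \<notin> conn_rel V F}"

definition separating_forests_with ::
    "'a set \<Rightarrow> 'a set set \<Rightarrow> 'a \<Rightarrow> 'a \<Rightarrow> 'a \<Rightarrow> 'a set set set" where
  "separating_forests_with V E s1 q s2 =
     {F \<in> separating_forests V E s1 s2. (s1, q) \<in> conn_rel V F}"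

definition max_forest_weight ::
    "'a set \<Rightarrow> 'a set set \<Rightarrow> ('a set \<Rightarrow> real) \<Rightarrow> 'a \<Rightarrow> 'a \<Rightarrow> real" where
  "max_forest_weight V E w s1 s2 = Max (forest_weight w ` separating_forests V E s1 s2)"

text \<open>The squared difference across an unordered edge is independent of how its end points
  are named.\<close>

definition edge_sqdiff :: "('a \<Rightarrow> real) \<Rightarrow> 'a set \<Rightarrow> real" where
  "edge_sqdiff x e = (THE d. \<exists>u v. e = {u, v} \<and> d = (x u - x v)\<^sup>2)"

lemma edge_sqdiff_insert [simp]: "edge_sqdiff x {u, v} = (x u - x v)\<^sup>2"
  unfolding edge_sqdiff_def
  by (rule the_equality) (auto simp: doubleton_eq_iff power2_commute)

definition rw_energy ::
    "'a set set \<Rightarrow> ('a set \<Rightarrow> real) \<Rightarrow> real \<Rightarrow> ('a \<Rightarrow> real) \<Rightarrow> real" where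
  "rw_energy E w \<alpha> x = (\<Sum>e\<in>E. (w e powr \<alpha>) * edge_sqdiff x e)"

text \<open>Potentials are taken in \<open>extensional V\<close>, so that values off \<open>V\<close>, which the energy does
  not see, do not spoil uniqueness of the minimizer.\<close>

definition rw_feasible :: "'a set \<Rightarrow> 'a \<Rightarrow> 'a \<Rightarrow> ('a \<Rightarrow> real) set" where
  "rw_feasible V s1 s2 = {x \<in> extensional V. x s1 = 1 \<and> x s2 = 0}"

definition rw_potential ::
    "'a set \<Rightarrow> 'a set set \<Rightarrow> ('a set \<Rightarrow> real) \<Rightarrow> 'a \<Rightarrow> 'a \<Rightarrow> real \<Rightarrow> 'a \<Rightarrow> real" where
  "rw_potential V E w s1 s2 \<alpha> =
     (THE x. is_arg_min (rw_energy E w \<alpha>) (\<lambda>x. x \<in> rw_feasible V s1 s2) x)"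

definition pw_potential ::
    "'a set \<Rightarrow> 'a set set \<Rightarrow> ('a set \<Rightarrow> real) \<Rightarrow> 'a \<Rightarrow> 'a \<Rightarrow> 'a \<Rightarrow> real" where
  "pw_potential V E w s1 s2 q = Lim at_top (\<lambda>\<alpha>. rw_potential V E w s1 s2 \<alpha> q)"

end

theory Submission
  imports Defs
begin

text \<open>
  For fixed \<open>\<alpha>\<close> the random walker potential of \<open>q\<close> is the probability that \<open>q\<close> lies in the tree
  of \<open>s1\<close> when a separating 2-forest is drawn with probability proportional to its weight to the
  power \<open>\<alpha>\<close>. This ratio has the right boundary values and is harmonic at every other vertex \<open>v\<close>:
  the flow out of \<open>v\<close> and the flow into \<open>v\<close> are both the total weight of the spanning trees whose
  path from \<open>s1\<close> to \<open>s2\<close> passes through \<open>v\<close>, obtained by adding to a 2-forest the edge that leaves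
  \<open>v\<close>, respectively enters \<open>v\<close>. Harmonicity makes the ratio the unique minimizer of the energy. As
  \<open>\<alpha> \<rightarrow> \<infinity>\<close>, only the forests of maximal weight survive in the ratio.
\<close>

section \<open>Reachability and acyclic edge sets\<close>

abbreviation reach :: "'a set set \<Rightarrow> 'a \<Rightarrow> 'a \<Rightarrow> bool" where
  "reach F u v \<equiv> (u, v) \<in> (adj_rel F)\<^sup>*"

lemma sym_adj_rel: "sym (adj_rel F)"
  by (auto simp: adj_rel_def sym_def insert_commute)

lemma reach_sym: "reach F u v \<Longrightarrow> reach F v u"
  using sym_rtrancl[OF sym_adj_rel] by (metis symD)

lemma reach_sym_iff: "reach F u v \<longleftrightarrow> reach F v u"
  using reach_sym by metis

lemma reach_trans: "reach F u v \<Longrightarrow> reach F v x \<Longrightarrow> reach F u x"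
  by (rule rtrancl_trans)

lemma reach_mono: "reach F u v \<Longrightarrow> F \<subseteq> G \<Longrightarrow> reach G u v"
  by (rule subsetD[OF rtrancl_mono]) (auto simp: adj_rel_def)

lemma reach_edge: "{u, v} \<in> F \<Longrightarrow> reach F u v"
  by (cases "u = v") (auto simp: adj_rel_def)

text \<open>A walk can be shortened until it crosses the new edge at most once; the two extra cases
  are the two directions of that crossing.\<close>

lemma reach_insert:
  assumes "u \<noteq> v"
  shows "reach (insert {u, v} F) a b \<longleftrightarrow>
    reach F a b \<or> reach F a u \<and> reach F v b \<or> reach F a v \<and> reach F u b"
proof -
  have "adj_rel (insert {u, v} F) = insert (u, v) (insert (v, u) (adj_rel F))"
    using assms by (auto simp: adj_rel_def doubleton_eq_iff)
  then show ?thesis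
    by (auto simp: rtrancl_insert intro: reach_trans)
qed

lemma reach_remove:
  assumes "u \<noteq> v" "{u, v} \<in> T"
  shows "reach T a b \<longleftrightarrow> reach (T - {{u, v}}) a b \<or>
    reach (T - {{u, v}}) a u \<and> reach (T - {{u, v}}) v b \<or>
    reach (T - {{u, v}}) a v \<and> reach (T - {{u, v}}) u b"
  using reach_insert[OF assms(1), where F = "T - {{u, v}}"] assms(2) by (simp add: insert_absorb)

text \<open>Loop erasure: when the next vertex already lies on the path, the path is cut back to it
  instead of being extended.\<close>

lemma reach_distinct_path:
  assumes "reach F u v"
  shows "\<exists>p. p \<noteq> [] \<and> hd p = u \<and> last p = v \<and> distinct p \<and>
    (\<forall>i. Suc i < length p \<longrightarrow> {p ! i, p ! Suc i} \<in> F)"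
  using assms
proof (induction rule: rtrancl_induct)
  case base
  show ?case by (rule exI[of _ "[u]"]) simp
next
  case (step y z)
  then obtain p where p: "p \<noteq> []" "hd p = u" "last p = y" "distinct p"
    "\<And>i. Suc i < length p \<Longrightarrow> {p ! i, p ! Suc i} \<in> F"
    by blast
  have yz: "{y, z} \<in> F" using step(2) by (simp add: adj_rel_def)
  show ?case
  proof (cases "z \<in> set p")
    case True
    then obtain k where k: "k < length p" "p ! k = z" by (auto simp: in_set_conv_nth)
    let ?p = "take (Suc k) p"
    have "hd ?p = u" using p by (cases p) auto
    moreover have "last ?p = z" using k by (simp add: take_Suc_conv_app_nth)
    moreover have "distinct ?p" using p by simp
    moreover have "?p \<noteq> []" using p by simp
    ultimately show ?thesis using p(5) k by (intro exI[of _ ?p]) auto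
  next
    case False
    let ?p = "p @ [z]"
    have "{?p ! i, ?p ! Suc i} \<in> F" if "Suc i < length ?p" for i
    proof (cases "Suc i < length p")
      case True
      then show ?thesis using p(5) by (simp add: nth_append)
    next
      case False
      then have "Suc i = length p" using that by simp
      moreover from this have "p ! i = y" using p(1,3) by (metis diff_Suc_1 last_conv_nth)
      ultimately show ?thesis using yz by (simp add: nth_append)
    qed
    then show ?thesis using p False by (intro exI[of _ ?p]) auto
  qed
qed

text \<open>Every edge is a bridge. Unlike the absence of a cyclic vertex list, this form fits the
  addition and removal of single edges.\<close>

definition acyclic_edges :: "'a set set \<Rightarrow> bool" where
  "acyclic_edges F \<longleftrightarrow> (\<forall>u v. u \<noteq> v \<longrightarrow> {u, v} \<in> F \<longrightarrow> \<not> reach (F - {{u, v}}) u v)"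

lemma acyclic_edgesD:
  "acyclic_edges F \<Longrightarrow> u \<noteq> v \<Longrightarrow> {u, v} \<in> F \<Longrightarrow> \<not> reach (F - {{u, v}}) u v"
  by (simp add: acyclic_edges_def)

text \<open>A cycle leads around its own closing edge, which is then no bridge. Conversely, a simple
  path between the ends of an edge that avoids this edge is closed by it to a cycle.\<close>

lemma acyclic_edges_iff: "acyclic_edges F \<longleftrightarrow> (\<nexists>p. is_cycle F p)"
proof
  assume ac: "acyclic_edges F"
  show "\<nexists>p. is_cycle F p"
  proof
    assume "\<exists>p. is_cycle F p"
    then obtain p where p: "3 \<le> length p" "distinct p"
      "\<And>i. i < length p \<Longrightarrow> {p ! i, p ! (Suc i mod length p)} \<in> F"
      by (auto simp: is_cycle_def)
    define m where "m = length p - 1"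
    have m: "length p = Suc m" "2 \<le> m" using p(1) by (auto simp: m_def)
    let ?e = "{p ! 0, p ! m}"
    have "reach (F - {?e}) (p ! 0) (p ! k)" if "k \<le> m" for k
      using that
    proof (induction k)
      case (Suc k)
      have "{p ! k, p ! Suc k} \<in> F" using p(3)[of k] Suc.prems m by simp
      \<comment> \<open>Here \<open>2 \<le> m\<close> matters: the closing edge joins the positions
        \<open>0\<close> and \<open>m\<close>, which are not consecutive.\<close>
      moreover have "{p ! k, p ! Suc k} \<noteq> ?e"
        using Suc.prems m p(2) by (auto simp: doubleton_eq_iff nth_eq_iff_index_eq)
      ultimately have "reach (F - {?e}) (p ! k) (p ! Suc k)" by (intro reach_edge) auto
      then show ?case using Suc by (auto intro: reach_trans)
    qed simp
    moreover have "?e \<in> F" using p(3)[of m] m by (simp add: insert_commute)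
    moreover have "p ! 0 \<noteq> p ! m" using p(2) m by (simp add: nth_eq_iff_index_eq)
    ultimately show False using acyclic_edgesD[OF ac] by blast
  qed
next
  assume nc: "\<nexists>p. is_cycle F p"
  show "acyclic_edges F"
    unfolding acyclic_edges_def
  proof (intro allI impI notI)
    fix u v
    assume uv: "u \<noteq> v" "{u, v} \<in> F" and "reach (F - {{u, v}}) u v"
    then obtain p where p: "p \<noteq> []" "hd p = u" "last p = v" "distinct p"
      "\<And>i. Suc i < length p \<Longrightarrow> {p ! i, p ! Suc i} \<in> F - {{u, v}}"
      using reach_distinct_path[of u v "F - {{u, v}}"] by blast
    have h: "p ! 0 = u" "p ! (length p - 1) = v"
      using p by (auto simp: hd_conv_nth last_conv_nth)
    have "length p \<noteq> 0" "length p \<noteq> 1" using p(1) h uv by auto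
    \<comment> \<open>A path with two vertices would consist of the removed edge
      \<open>{u, v}\<close> itself.\<close>
    moreover have "length p \<noteq> 2" using p(5)[of 0] h by auto
    ultimately have l: "3 \<le> length p" by linarith
    have "{p ! i, p ! (Suc i mod length p)} \<in> F" if "i < length p" for i
    proof (cases "Suc i < length p")
      case False
      then have i: "Suc i = length p" using that by simp
      then have "p ! i = v" using h by (metis diff_Suc_1)
      then show ?thesis using h uv i by (simp add: insert_commute)
    qed (use p(5) in auto)
    then have "is_cycle F p" using l p(4) by (simp add: is_cycle_def)
    then show False using nc by blast
  qed
qed

lemma acyclic_edges_mono: "acyclic_edges F \<Longrightarrow> G \<subseteq> F \<Longrightarrow> acyclic_edges G"
  by (auto simp: acyclic_edges_iff is_cycle_def)

text \<open>If an old edge \<open>{a, b}\<close> stopped being a bridge, the detour between its ends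
  would run through \<open>{u, v}\<close>; the rest of the detour together with
  \<open>{a, b}\<close> would already join \<open>u\<close> and \<open>v\<close> in
  \<open>F\<close>.\<close>

lemma acyclic_edges_insert:
  assumes ac: "acyclic_edges F" and nr: "\<not> reach F u v"
  shows "acyclic_edges (insert {u, v} F)"
  unfolding acyclic_edges_def
proof (intro allI impI notI)
  fix a b
  assume ab: "a \<noteq> b" "{a, b} \<in> insert {u, v} F"
    and r: "reach (insert {u, v} F - {{a, b}}) a b"
  have uv: "u \<noteq> v" using nr by auto
  have uvF: "{u, v} \<notin> F" using nr reach_edge by metis
  show False
  proof (cases "{a, b} = {u, v}")
    case True
    then have "reach F a b" using r uvF by simp
    then show False using True nr reach_sym by (metis doubleton_eq_iff)
  next
    case False
    then have abF: "{a, b} \<in> F" using ab by simp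
    let ?F = "F - {{a, b}}"
    have eq: "insert {u, v} F - {{a, b}} = insert {u, v} ?F" using False by auto
    have "\<not> reach ?F a b" using acyclic_edgesD[OF ac ab(1) abF] .
    then have "reach ?F a u \<and> reach ?F v b \<or> reach ?F a v \<and> reach ?F u b"
      using r unfolding eq reach_insert[OF uv] by blast
    then have "reach F a u \<and> reach F v b \<or> reach F a v \<and> reach F u b"
      using reach_mono[of _ _ ?F F] by blast
    then have "reach F u v" using reach_edge[OF abF]
      by (meson reach_sym reach_trans)
    then show False using nr by simp
  qed
qed

text \<open>Up to its first arrival at \<open>v\<close>, a walk from \<open>s\<close> uses no edge
  at \<open>v\<close>; \<open>u\<close> is the vertex just before that arrival.\<close>

lemma reach_first_hit:
  assumes "reach F s v" "s \<noteq> v"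
  obtains u where "{u, v} \<in> F" "u \<noteq> v" "reach (F - {{u, v}}) s u"
proof -
  \<comment> \<open>Induction along the walk: either \<open>t\<close> is reached without any edge at
    \<open>v\<close>, or \<open>v\<close> has been entered from some \<open>u\<close>. At
    \<open>t = v\<close> only the second case is possible.\<close>
  have "reach {e \<in> F. v \<notin> e} s t \<or>
      (\<exists>u. {u, v} \<in> F \<and> u \<noteq> v \<and> reach {e \<in> F. v \<notin> e} s u)" if "reach F s t" for t
    using that
  proof (induction rule: rtrancl_induct)
    case (step y z)
    show ?case
    proof (cases "reach {e \<in> F. v \<notin> e} s y")
      case True
      have y: "y \<noteq> v"
      proof
        assume "y = v"
        with True \<open>s \<noteq> v\<close> show False
          by (cases rule: rtranclE) (auto simp: adj_rel_def)
      qed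
      have yz: "{y, z} \<in> F" using step(2) by (simp add: adj_rel_def)
      show ?thesis
      proof (cases "z = v")
        case False
        then have "reach {e \<in> F. v \<notin> e} y z" using y yz by (intro reach_edge) auto
        then show ?thesis using reach_trans[OF True] by blast
      next
        case True
        then show ?thesis using \<open>reach {e \<in> F. v \<notin> e} s y\<close> y yz by blast
      qed
    next
      case False
      then show ?thesis using step.IH by blast
    qed
  qed blast
  moreover have "\<not> reach {e \<in> F. v \<notin> e} s v"
  proof
    assume "reach {e \<in> F. v \<notin> e} s v"
    then show False using assms(2) by (cases rule: rtranclE) (auto simp: adj_rel_def)
  qed
  ultimately obtain u where "{u, v} \<in> F" "u \<noteq> v" "reach {e \<in> F. v \<notin> e} s u"
    using assms(1) by blast
  moreover from this have "reach (F - {{u, v}}) s u"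
    by (elim reach_mono) auto
  ultimately show ?thesis using that by blast
qed

section \<open>Separating forests and edge swaps\<close>

lemma equiv_conn_rel: "equiv V (conn_rel V F)"
proof (rule equivI)
  show "sym (conn_rel V F)"
    using reach_sym by (fastforce simp: conn_rel_def sym_def)
  show "trans (conn_rel V F)"
    using reach_trans by (fastforce simp: conn_rel_def trans_def)
qed (auto simp: conn_rel_def refl_on_def)

text \<open>The seeds already occupy two different classes, so there being exactly two classes means
  that these two cover \<open>V\<close>.\<close>

lemma card_conn_components_eq_2_iff:
  assumes "s1 \<in> V" "s2 \<in> V" "\<not> reach F s1 s2"
  shows "card (conn_components V F) = 2 \<longleftrightarrow> (\<forall>x\<in>V. reach F x s1 \<or> reach F x s2)"
proof -
  let ?r = "conn_rel V F"
  define C where "C x = ?r `` {x}" for x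
  have C_eq: "C x = C y \<longleftrightarrow> reach F x y" if "x \<in> V" "y \<in> V" for x y
    using eq_equiv_class_iff[OF equiv_conn_rel that] that
    by (simp add: conn_rel_def C_def)
  have im: "conn_components V F = C ` V"
    by (auto simp: conn_components_def quotient_def C_def)
  have ne: "C s1 \<noteq> C s2" using C_eq assms by blast
  show ?thesis
  proof
    assume "card (conn_components V F) = 2"
    \<comment> \<open>An infinite set has \<open>card\<close> 0, so the value 2 already gives
      finiteness.\<close>
    moreover from this have "finite (conn_components V F)" by (metis card.infinite zero_neq_numeral)
    moreover have "{C s1, C s2} \<subseteq> conn_components V F" using assms im by auto
    moreover have "card {C s1, C s2} = 2" using ne by simp
    ultimately have "C ` V = {C s1, C s2}" unfolding im by (metis card_subset_eq)
    then have "C x = C s1 \<or> C x = C s2" if "x \<in> V" for x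
      using that by blast
    then show "\<forall>x\<in>V. reach F x s1 \<or> reach F x s2"
      using C_eq assms(1,2) by metis
  next
    assume "\<forall>x\<in>V. reach F x s1 \<or> reach F x s2"
    then have "C x = C s1 \<or> C x = C s2" if "x \<in> V" for x
      using that C_eq assms(1,2) by metis
    then have "C ` V = {C s1, C s2}" using assms(1,2) by blast
    then show "card (conn_components V F) = 2" using ne im by simp
  qed
qed

lemma separating_forests_iff:
  assumes "s1 \<in> V" "s2 \<in> V"
  shows "F \<in> separating_forests V E s1 s2 \<longleftrightarrow> F \<subseteq> E \<and> acyclic_edges F \<and>
    \<not> reach F s1 s2 \<and> (\<forall>x\<in>V. reach F x s1 \<or> reach F x s2)"
proof -
  have "(s1, s2) \<in> conn_rel V F \<longleftrightarrow> reach F s1 s2"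
    using assms by (simp add: conn_rel_def)
  then show ?thesis
    using card_conn_components_eq_2_iff[OF assms, of F]
    unfolding separating_forests_def spanning_forest_def acyclic_edges_iff mem_Collect_eq
    by metis
qed

lemma separating_forests_commute:
  assumes "s1 \<in> V" "s2 \<in> V"
  shows "separating_forests V E s1 s2 = separating_forests V E s2 s1"
  unfolding set_eq_iff separating_forests_iff[OF assms] separating_forests_iff[OF assms(2,1)]
  by (metis reach_sym_iff)

text \<open>An inclusion-maximal acyclic edge set that separates the seeds reaches every vertex from
  one of them; otherwise one more edge could be added.\<close>

lemma separating_forests_nonempty:
  assumes "finite E" "\<And>e. e \<in> E \<Longrightarrow> e \<subseteq> V \<and> card e = 2" "connected_graph V E"
    and s: "s1 \<in> V" "s2 \<in> V" "s1 \<noteq> s2"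
  shows "separating_forests V E s1 s2 \<noteq> {}"
proof -
  let ?P = "{F. F \<subseteq> E \<and> acyclic_edges F \<and> \<not> reach F s1 s2}"
  have "finite ?P" using assms(1) by (intro finite_subset[of ?P "Pow E"]) auto
  moreover have "{} \<in> ?P" using s by (simp add: acyclic_edges_def adj_rel_def)
  ultimately have "\<exists>F\<in>?P. {} \<subseteq> F \<and> (\<forall>G\<in>?P. F \<subseteq> G \<longrightarrow> F = G)"
    by (rule finite_has_maximal2)
  then obtain F where F: "F \<in> ?P" and max: "\<forall>G\<in>?P. F \<subseteq> G \<longrightarrow> F = G"
    by (elim bexE conjE)
  have ex: "reach F x s1 \<or> reach F x s2" if "x \<in> V" for x
  proof (rule ccontr)
    assume nx: "\<not> (reach F x s1 \<or> reach F x s2)"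
    have "reach E s1 x" using assms(3) s that by (auto simp: connected_graph_def conn_rel_def)
    \<comment> \<open>Along a walk in \<open>E\<close> from \<open>s1\<close> to the uncovered
      \<open>x\<close>, some edge leads from a covered vertex \<open>a\<close> to an uncovered
      vertex \<open>b\<close>.\<close>
    then have "\<exists>a b. {a, b} \<in> E \<and> (reach F a s1 \<or> reach F a s2) \<and> \<not> (reach F b s1 \<or> reach F b s2)"
      using nx
    proof (induction rule: rtrancl_induct)
      case (step y z)
      then show ?case by (auto simp: adj_rel_def)
    qed auto
    then obtain a b where ab: "{a, b} \<in> E" "reach F a s1 \<or> reach F a s2"
      "\<not> reach F b s1" "\<not> reach F b s2" by blast
    have nab: "\<not> reach F a b" using ab reach_sym reach_trans by metis
    then have "a \<noteq> b" by auto
    have "\<not> reach (insert {a, b} F) s1 s2"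
      unfolding reach_insert[OF \<open>a \<noteq> b\<close>]
      using ab(3,4) F reach_sym[of s1 b F] by auto
    then have "insert {a, b} F \<in> ?P" using F ab acyclic_edges_insert[OF _ nab] by auto
    then have "F = insert {a, b} F" using max by (meson subset_insertI)
    then have "{a, b} \<in> F" by blast
    then show False using nab reach_edge by metis
  qed
  then have "F \<in> separating_forests V E s1 s2"
    using F separating_forests_iff[OF s(1,2)] by auto
  then show ?thesis by blast
qed

text \<open>For seeds in \<open>V\<close>, \<open>v\<close> lies in the tree of \<open>s1\<close>
  and \<open>u\<close> in that of \<open>s2\<close>. Adding \<open>{u, v}\<close> gives a spanning
  tree whose path from \<open>s1\<close> to \<open>s2\<close> leaves \<open>v\<close> towards
  \<open>u\<close>. Exchanging the seeds describes the edge by which the path enters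
  \<open>v\<close>.\<close>

definition swap_pairs :: "'a set \<Rightarrow> 'a set set \<Rightarrow> 'a \<Rightarrow> 'a \<Rightarrow> 'a \<Rightarrow> ('a \<times> 'a set set) set" where
  "swap_pairs V E s1 s2 v = {(u, F). F \<in> separating_forests V E s1 s2 \<and> u \<in> V \<and> {u, v} \<in> E \<and>
     reach F s1 v \<and> \<not> reach F s1 u}"

text \<open>The tree determines \<open>u\<close>, the successor of \<open>v\<close> on the path from
  \<open>s1\<close> to \<open>s2\<close>, and hence \<open>F\<close>.\<close>

lemma swap_pairs_inj:
  assumes s: "s1 \<in> V" "s2 \<in> V"
  shows "inj_on (\<lambda>(u, F). insert {u, v} F) (swap_pairs V E s1 s2 v)"
proof (rule inj_onI, clarify)
  fix u F u' F'
  assume A: "(u, F) \<in> swap_pairs V E s1 s2 v" "(u', F') \<in> swap_pairs V E s1 s2 v"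
    and eq: "insert {u, v} F = insert {u', v} F'"
  have F: "acyclic_edges F" "\<not> reach F s1 s2" "reach F s1 v" "\<not> reach F s1 u" "reach F u s2"
    using A(1) s reach_sym[of u s1 F] unfolding swap_pairs_def
    by (auto simp: separating_forests_iff)
  have F': "\<not> reach F' s1 s2" "reach F' s1 v" "\<not> reach F' s1 u'" "reach F' u' s2"
    using A(2) s reach_sym[of u' s1 F'] unfolding swap_pairs_def
    by (auto simp: separating_forests_iff)
  have ne: "u \<noteq> v" "u' \<noteq> v" using F F' by auto
  have nuv: "\<not> reach F u v" using F reach_sym reach_trans by metis
  have nuv': "\<not> reach F' u' v" using F' reach_sym reach_trans by metis
  have nin: "{u, v} \<notin> F" "{u', v} \<notin> F'"
    using nuv nuv' reach_edge by metis+
  have "u = u'"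
  proof (rule ccontr)
    assume "u \<noteq> u'"
    then have dist: "{u, v} \<noteq> {u', v}" by (auto simp: doubleton_eq_iff)
    then have in': "{u', v} \<in> F" "{u, v} \<in> F'" using eq by (metis insert_iff)+
    \<comment> \<open>If \<open>u\<close> and \<open>u'\<close> differ, \<open>?F0\<close> is the
      common part of \<open>F\<close> and \<open>F'\<close>. The connection from \<open>u\<close> to
      \<open>s2\<close> survives in it, so in \<open>F'\<close> the edge \<open>{u, v}\<close> would
      link \<open>v\<close>, hence \<open>s1\<close>, to \<open>s2\<close>.\<close>
    let ?F0 = "F - {{u', v}}"
    have F0: "?F0 = F' - {{u, v}}" using eq nin dist by blast
    have "reach ?F0 u s2 \<or> reach ?F0 u u' \<and> reach ?F0 v s2 \<or> reach ?F0 u v"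
      using F(5) reach_remove[OF ne(2) in'(1)] by blast
    moreover have "\<not> reach ?F0 v s2" "\<not> reach ?F0 u v"
      using F nuv reach_mono[of _ _ ?F0 F] by (auto intro: reach_trans)
    ultimately have "reach F' u s2" using F0 reach_mono[of _ _ ?F0 F'] by auto
    then show False using reach_edge[OF in'(2)] F' reach_sym reach_trans by metis
  qed
  then show "u = u' \<and> F = F'" using eq nin by (metis insert_ident)
qed

text \<open>The path of the tree runs \<open>s1\<close>, ..., \<open>u'\<close>, \<open>v\<close>,
  \<open>u\<close>, ..., \<open>s2\<close>. Deleting \<open>{u', v}\<close> instead of
  \<open>{u, v}\<close> moves \<open>v\<close> to the side of \<open>s2\<close> and exhibits the
  same tree with the seeds exchanged.\<close>

lemma swap_pairs_image_subset:
  assumes s: "s1 \<in> V" "s2 \<in> V" and v: "v \<in> V" "v \<noteq> s1" and E: "\<And>e. e \<in> E \<Longrightarrow> e \<subseteq> V"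
  shows "(\<lambda>(u, F). insert {u, v} F) ` swap_pairs V E s1 s2 v
    \<subseteq> (\<lambda>(u, F). insert {u, v} F) ` swap_pairs V E s2 s1 v"
proof clarify
  fix u F
  assume A: "(u, F) \<in> swap_pairs V E s1 s2 v"
  let ?T = "insert {u, v} F"
  have F: "F \<subseteq> E" "acyclic_edges F" "\<not> reach F s1 s2" "reach F s1 v" "\<not> reach F s1 u"
    "reach F u s2" "{u, v} \<in> E" and cover: "\<forall>x\<in>V. reach F x s1 \<or> reach F x s2"
    using A s reach_sym[of u s1 F] unfolding swap_pairs_def
    by (auto simp: separating_forests_iff)
  \<comment> \<open>The predecessor of \<open>v\<close> on the path exists because \<open>v\<close>
    is not \<open>s1\<close>.\<close>
  obtain u' where u': "{u', v} \<in> F" "u' \<noteq> v" "reach (F - {{u', v}}) s1 u'"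
    using reach_first_hit[OF F(4)] v by metis
  have u'V: "u' \<in> V" using u'(1) F(1) E by blast
  \<comment> \<open>\<open>?G\<close> is the new 2-forest; \<open>?F\<close> lacks both path edges
    at \<open>v\<close> and is contained in both forests, so connections in it carry over.\<close>
  let ?F = "F - {{u', v}}" and ?G = "?T - {{u', v}}"
  have sub: "reach F a b" if "reach ?F a b" for a b using that by (auto elim: reach_mono)
  have nuv: "\<not> reach F u v" using F reach_sym reach_trans by metis
  have acT: "acyclic_edges ?T" using acyclic_edges_insert[OF F(2) nuv] .
  have uu': "u \<noteq> u'" using F(5) sub[OF u'(3)] by auto
  then have uv_in: "{u, v} \<in> ?G" by (auto simp: doubleton_eq_iff)
  have FG: "reach ?G a b" if "reach ?F a b" for a b using that by (auto elim: reach_mono)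
  have u'T: "{u', v} \<in> ?T" using u' by simp
  have nG: "\<not> reach ?G u' v" using acyclic_edgesD[OF acT u'(2) u'T] .
  have s1u': "reach ?G s1 u'" using FG u'(3) .
  have "\<not> reach F u u'" using F(5) sub[OF u'(3)] reach_sym reach_trans by metis
  \<comment> \<open>Neither \<open>v\<close> nor \<open>u'\<close> is in the tree of
    \<open>u\<close>, so the connection to \<open>s2\<close> does not use
    \<open>{u', v}\<close>.\<close>
  then have "reach ?F u s2"
    using F(6) nuv sub unfolding reach_remove[OF u'(2,1)] by blast
  then have vs2: "reach ?G v s2" using FG reach_edge[OF uv_in] reach_sym reach_trans by metis
  have "\<not> reach ?G s1 s2" using nG s1u' vs2 reach_sym reach_trans by metis
  moreover have "reach ?G x s1 \<or> reach ?G x s2" if "x \<in> V" for x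
  proof -
    \<comment> \<open>The edge \<open>{u, v}\<close> joins the two trees of \<open>F\<close>, so
      \<open>?T\<close> spans \<open>V\<close>; cutting \<open>{u', v}\<close> then leaves each
      vertex attached to \<open>u'\<close> or to \<open>v\<close>.\<close>
    have "reach ?T s1 v" "reach ?T v u" "reach ?T u s2"
      using F reach_mono[of _ _ F ?T] reach_edge[of v u ?T] by (auto simp: insert_commute)
    then have "reach ?T s1 s2" using reach_trans by metis
    moreover have "reach ?T x s1 \<or> reach ?T x s2"
      using cover that reach_mono[of _ _ F ?T] by blast
    ultimately have "reach ?T x s1" using reach_sym reach_trans by metis
    then have "reach ?G x s1 \<or> reach ?G x u' \<or> reach ?G x v"
      unfolding reach_remove[OF u'(2) u'T] by blast
    then show ?thesis using reach_sym[OF s1u'] vs2 by (blast intro: reach_trans)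
  qed
  moreover have "?G \<subseteq> E" "acyclic_edges ?G"
    using F acyclic_edges_mono[OF acT] by auto
  ultimately have "?G \<in> separating_forests V E s2 s1"
    using s reach_sym_iff[of s1 s2 ?G] by (auto simp: separating_forests_iff)
  moreover have "\<not> reach ?G s2 u'" using nG vs2 reach_sym reach_trans by metis
  ultimately have "(u', ?G) \<in> swap_pairs V E s2 s1 v"
    using reach_sym[OF vs2] u'V u'(1) F(1) by (auto simp: swap_pairs_def)
  moreover have "?T = insert {u', v} ?G" using u'(1) by auto
  ultimately show "?T \<in> (\<lambda>(u, F). insert {u, v} F) ` swap_pairs V E s2 s1 v"
    by (intro image_eqI[of _ _ "(u', ?G)"]) simp_all
qed

text \<open>The inclusion above, used with the seeds in both orders, shows that both sides range
  over the same spanning trees; injectivity ensures that each is counted once.\<close>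

lemma swap_pairs_sum_eq:
  fixes g :: "'a set set \<Rightarrow> real"
  assumes s: "s1 \<in> V" "s2 \<in> V" and v: "v \<in> V" "v \<noteq> s1" "v \<noteq> s2"
    and E: "\<And>e. e \<in> E \<Longrightarrow> e \<subseteq> V"
  shows "(\<Sum>(u, F)\<in>swap_pairs V E s1 s2 v. g (insert {u, v} F)) =
    (\<Sum>(u, F)\<in>swap_pairs V E s2 s1 v. g (insert {u, v} F))"
proof -
  let ?t = "\<lambda>(u, F). insert {u, v} F"
  have *: "(\<Sum>(u, F)\<in>swap_pairs V E a b v. g (insert {u, v} F)) =
      sum g (?t ` swap_pairs V E a b v)" if "a \<in> V" "b \<in> V" for a b
    using sum.reindex[OF swap_pairs_inj[OF that], of g] by (simp add: case_prod_unfold comp_def)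
  have "?t ` swap_pairs V E s1 s2 v = ?t ` swap_pairs V E s2 s1 v"
    by (rule subset_antisym[OF swap_pairs_image_subset[OF s v(1,2) E]
          swap_pairs_image_subset[OF s(2,1) v(1,3) E]])
  then show ?thesis using *[OF s] *[OF s(2,1)] by simp
qed

section \<open>Dirichlet energy\<close>

text \<open>Each edge has two distinct ends and so comes from exactly two ordered pairs.\<close>

lemma edge_sum_eq_half_double_sum:
  fixes g :: "'a set \<Rightarrow> real"
  assumes "finite V" and E: "\<And>e. e \<in> E \<Longrightarrow> e \<subseteq> V \<and> card e = 2"
  shows "(\<Sum>e\<in>E. g e) = (\<Sum>u\<in>V. \<Sum>v\<in>V. if {u, v} \<in> E then g {u, v} else 0) / 2"
proof -
  let ?P = "{(u, v) \<in> V \<times> V. {u, v} \<in> E}" and ?e = "\<lambda>(u, v). {u, v}"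
  have fin: "finite ?P" using assms(1) by (auto intro: finite_subset[of _ "V \<times> V"])
  have fiber: "(\<Sum>p\<in>{p \<in> ?P. ?e p = e}. g (?e p)) = 2 * g e" if "e \<in> E" for e
  proof -
    have "card e = 2" using E[OF that] by blast
    then obtain a b where ab: "e = {a, b}" "a \<noteq> b" by (auto simp: card_2_iff)
    then have "a \<in> V" "b \<in> V" using E[OF that] by auto
    then have "{p \<in> ?P. ?e p = e} = {(a, b), (b, a)}"
      using ab that by (auto simp: doubleton_eq_iff insert_commute)
    then show ?thesis using ab by (simp add: insert_commute)
  qed
  have im: "?e ` ?P = E"
  proof
    show "E \<subseteq> ?e ` ?P"
    proof
      fix e assume e: "e \<in> E"
      then obtain a b where "e = {a, b}" using E[OF e] by (auto simp: card_2_iff)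
      then show "e \<in> ?e ` ?P" using E[OF e] e by (intro image_eqI[of _ _ "(a, b)"]) auto
    qed
  qed auto
  have "(\<Sum>u\<in>V. \<Sum>v\<in>V. if {u, v} \<in> E then g {u, v} else 0) = (\<Sum>p\<in>?P. g (?e p))"
    using assms(1) unfolding sum.cartesian_product
    by (intro sum.mono_neutral_cong_right) (auto split: if_splits)
  also have "\<dots> = (\<Sum>e\<in>E. 2 * g e)"
    unfolding sum.image_gen[OF fin, of "\<lambda>p. g (?e p)" ?e] im using fiber by (rule sum.cong[OF refl])
  finally show ?thesis by (simp add: sum_distrib_left[symmetric])
qed

definition dirichlet :: "'a set set \<Rightarrow> ('a set \<Rightarrow> real) \<Rightarrow> ('a \<Rightarrow> real) \<Rightarrow> real" where
  "dirichlet E c x = (\<Sum>e\<in>E. c e * edge_sqdiff x e)"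

text \<open>The value 0 off the edges lets sums over neighbours run over all of
  \<open>V\<close>.\<close>

definition conductance :: "'a set set \<Rightarrow> ('a set \<Rightarrow> real) \<Rightarrow> 'a \<Rightarrow> 'a \<Rightarrow> real" where
  "conductance E c u v = (if {u, v} \<in> E then c {u, v} else 0)"

lemma conductance_commute: "conductance E c u v = conductance E c v u"
  by (simp add: conductance_def insert_commute)

lemma dirichlet_eq_half_double_sum:
  assumes "finite V" and "\<And>e. e \<in> E \<Longrightarrow> e \<subseteq> V \<and> card e = 2"
  shows "dirichlet E c x = (\<Sum>u\<in>V. \<Sum>v\<in>V. conductance E c u v * (x u - x v)\<^sup>2) / 2"
proof -
  have "(if {u, v} \<in> E then c {u, v} * edge_sqdiff x {u, v} else 0) =
      conductance E c u v * (x u - x v)\<^sup>2" for u v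
    by (simp add: conductance_def)
  then show ?thesis
    using edge_sum_eq_half_double_sum[OF assms, of E "\<lambda>e. c e * edge_sqdiff x e"]
    by (simp add: dirichlet_def)
qed

text \<open>Discrete Green identity: the mixed term is a sum over \<open>v\<close> of
  \<open>h v\<close> times the weighted Laplacian of \<open>y\<close> at \<open>v\<close>, and one
  of the two factors always vanishes.\<close>

lemma dirichlet_add_orthogonal:
  assumes "finite V" and "\<And>e. e \<in> E \<Longrightarrow> e \<subseteq> V \<and> card e = 2"
    and harm: "\<And>v. v \<in> V \<Longrightarrow> h v \<noteq> 0 \<Longrightarrow> (\<Sum>u\<in>V. conductance E c u v * (y v - y u)) = 0"
  shows "dirichlet E c (\<lambda>v. y v + h v) = dirichlet E c y + dirichlet E c h"
proof -
  let ?k = "conductance E c"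
  have z: "(\<Sum>v\<in>V. \<Sum>u\<in>V. ?k u v * (y v - y u) * h v) = 0"
  proof (rule sum.neutral, rule ballI)
    fix v assume "v \<in> V"
    then show "(\<Sum>u\<in>V. ?k u v * (y v - y u) * h v) = 0"
      using harm[of v] by (cases "h v = 0") (auto simp: sum_distrib_right[symmetric])
  qed
  have z': "(\<Sum>u\<in>V. \<Sum>v\<in>V. ?k u v * (y u - y v) * h u) = 0"
    using z by (simp add: conductance_commute[of E c])
  have z'': "(\<Sum>u\<in>V. \<Sum>v\<in>V. ?k u v * (y v - y u) * h v) = 0"
    using z by (subst sum.swap)
  have "(\<Sum>u\<in>V. \<Sum>v\<in>V. ?k u v * ((y u + h u) - (y v + h v))\<^sup>2) =
     (\<Sum>u\<in>V. \<Sum>v\<in>V. ?k u v * (y u - y v)\<^sup>2 + ?k u v * (h u - h v)\<^sup>2 +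
        2 * (?k u v * (y u - y v) * h u) + 2 * (?k u v * (y v - y u) * h v))"
    by (intro sum.cong refl) (simp add: power2_eq_square algebra_simps)
  also have "\<dots> = (\<Sum>u\<in>V. \<Sum>v\<in>V. ?k u v * (y u - y v)\<^sup>2) +
      (\<Sum>u\<in>V. \<Sum>v\<in>V. ?k u v * (h u - h v)\<^sup>2)"
    by (simp only: sum.distrib sum_distrib_left[symmetric] z' z'' mult_zero_right add_0_right)
  finally have "(\<Sum>u\<in>V. \<Sum>v\<in>V. ?k u v * ((y u + h u) - (y v + h v))\<^sup>2) =
      (\<Sum>u\<in>V. \<Sum>v\<in>V. ?k u v * (y u - y v)\<^sup>2) + (\<Sum>u\<in>V. \<Sum>v\<in>V. ?k u v * (h u - h v)\<^sup>2)" .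
  moreover have "dirichlet E c x = (\<Sum>u\<in>V. \<Sum>v\<in>V. ?k u v * (x u - x v)\<^sup>2) / 2" for x
    using assms(1,2) by (rule dirichlet_eq_half_double_sum)
  ultimately show ?thesis by (simp only: add_divide_distrib)
qed

lemma dirichlet_nonneg:
  assumes "\<And>e. e \<in> E \<Longrightarrow> 0 \<le> c e" "\<And>e. e \<in> E \<Longrightarrow> card e = 2"
  shows "0 \<le> dirichlet E c x"
  unfolding dirichlet_def
proof (intro sum_nonneg mult_nonneg_nonneg)
  fix e assume e: "e \<in> E"
  show "0 \<le> c e" using assms e by simp
  show "0 \<le> edge_sqdiff x e" using assms(2)[OF e] by (auto simp: card_2_iff)
qed

text \<open>All summands are nonnegative, so each is 0; the positive coefficients then force equal
  values at the ends of every edge.\<close>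

lemma dirichlet_zero_reach:
  assumes "finite E" "\<And>e. e \<in> E \<Longrightarrow> 0 < c e" "\<And>e. e \<in> E \<Longrightarrow> card e = 2"
    and "dirichlet E c x = 0" and "reach E u v"
  shows "x u = x v"
  using assms(5)
proof (induction rule: rtrancl_induct)
  case (step y z)
  have "0 \<le> c e * edge_sqdiff x e" if "e \<in> E" for e
    using assms(2,3)[OF that] by (auto simp: card_2_iff)
  then have "\<forall>e\<in>E. c e * edge_sqdiff x e = 0"
    using assms(4) unfolding dirichlet_def by (simp add: sum_nonneg_eq_0_iff[OF assms(1)])
  moreover have "{y, z} \<in> E" using step(2) by (simp add: adj_rel_def)
  ultimately have "c {y, z} * (x y - x z)\<^sup>2 = 0" "0 < c {y, z}"
    using assms(2) by fastforce+
  then show ?case using step.IH by simp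
qed simp

section \<open>The forest formula for the random walker\<close>

lemma sum_swap_pairs:
  fixes g :: "'a \<Rightarrow> 'a set set \<Rightarrow> real"
  assumes "finite V" "finite (separating_forests V E s1 s2)"
  shows "(\<Sum>(u, F)\<in>swap_pairs V E s1 s2 v. g u F) =
    (\<Sum>u\<in>V. \<Sum>F\<in>separating_forests V E s1 s2.
       if {u, v} \<in> E \<and> reach F s1 v \<and> \<not> reach F s1 u then g u F else 0)"
  using assms unfolding sum.cartesian_product
  by (intro sum.mono_neutral_cong_left) (auto simp: swap_pairs_def split: if_splits)

lemma finite_separating_forests: "finite E \<Longrightarrow> finite (separating_forests V E s1 s2)"
  by (rule finite_subset[of _ "Pow E"]) (auto simp: separating_forests_def spanning_forest_def)

text \<open>In \<open>N v - N u\<close> the forests with \<open>u\<close> and \<open>v\<close> on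
  the same side cancel. The factor \<open>c {u, v}\<close> turns each remaining product into that of
  a spanning tree, and the two signs correspond to the two orders of the seeds in
  \<open>swap_pairs\<close>.\<close>

lemma forest_sum_harmonic:
  fixes c :: "'a set \<Rightarrow> real"
  assumes fin: "finite V" "finite E" and E: "\<And>e. e \<in> E \<Longrightarrow> e \<subseteq> V"
    and s: "s1 \<in> V" "s2 \<in> V" and v: "v \<in> V" "v \<noteq> s1" "v \<noteq> s2"
  defines "N \<equiv> \<lambda>x. \<Sum>F\<in>separating_forests_with V E s1 x s2. prod c F"
  shows "(\<Sum>u\<in>V. conductance E c u v * (N v - N u)) = 0"
proof -
  let ?S = "separating_forests V E s1 s2"
  have finS: "finite ?S" using finite_separating_forests[OF fin(2)] .
  have N: "N x = (\<Sum>F\<in>?S. if reach F s1 x then prod c F else 0)" if "x \<in> V" for x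
    unfolding N_def separating_forests_with_def using finS s that
    by (simp add: sum.inter_filter conn_rel_def)
  have side: "reach F s2 x \<longleftrightarrow> \<not> reach F s1 x" if "F \<in> ?S" "x \<in> V" for F x
  proof -
    have "\<not> reach F s1 s2" "reach F x s1 \<or> reach F x s2"
      using that s by (auto simp: separating_forests_iff)
    then show ?thesis by (metis reach_sym reach_trans)
  qed
  have ins: "prod c (insert {u, v} F) = c {u, v} * prod c F"
    if F: "F \<in> ?S" and ne: "reach F s1 v \<noteq> reach F s1 u" for F u
  proof -
    have "F \<subseteq> E" using F by (simp add: separating_forests_def spanning_forest_def)
    then have "finite F" using fin(2) finite_subset by blast
    \<comment> \<open>The ends lie in different trees, so the insertion contributes exactly one new
      factor.\<close>
    moreover have "{u, v} \<notin> F"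
      using ne by (metis reach_edge reach_sym reach_trans)
    ultimately show ?thesis by simp
  qed
  let ?A = "\<lambda>u F. if {u, v} \<in> E \<and> reach F s1 v \<and> \<not> reach F s1 u then prod c (insert {u, v} F) else 0"
  let ?B = "\<lambda>u F. if {u, v} \<in> E \<and> reach F s2 v \<and> \<not> reach F s2 u then prod c (insert {u, v} F) else 0"
  have "(\<Sum>u\<in>V. conductance E c u v * (N v - N u)) = (\<Sum>u\<in>V. \<Sum>F\<in>?S. ?A u F - ?B u F)"
  proof (rule sum.cong[OF refl])
    fix u assume u: "u \<in> V"
    have "conductance E c u v * (N v - N u) = (\<Sum>F\<in>?S. conductance E c u v *
        ((if reach F s1 v then prod c F else 0) - (if reach F s1 u then prod c F else 0)))"
      unfolding N[OF u] N[OF v(1)] sum_subtractf[symmetric] sum_distrib_left ..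
    also have "\<dots> = (\<Sum>F\<in>?S. ?A u F - ?B u F)"
      by (rule sum.cong[OF refl]) (use u v in \<open>simp add: side ins conductance_def\<close>)
    finally show "conductance E c u v * (N v - N u) = (\<Sum>F\<in>?S. ?A u F - ?B u F)" .
  qed
  also have "\<dots> = (\<Sum>u\<in>V. \<Sum>F\<in>?S. ?A u F) - (\<Sum>u\<in>V. \<Sum>F\<in>?S. ?B u F)"
    by (simp only: sum_subtractf)
  also have "\<dots> = 0"
    using swap_pairs_sum_eq[OF s v E, of E "prod c"] finS
      sum_swap_pairs[OF fin(1), of E s1 s2 "\<lambda>u F. prod c (insert {u, v} F)" v]
      sum_swap_pairs[OF fin(1), of E s2 s1 "\<lambda>u F. prod c (insert {u, v} F)" v]
    unfolding separating_forests_commute[OF s(2,1)] by simp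
  finally show ?thesis .
qed

lemma (in weighted_graph) finite_E: "finite E"
  using edges by (intro finite_subset[of E "Pow V"]) (auto simp: finite_V)

lemma (in weighted_graph) forest_weight_pos:
  assumes "F \<subseteq> E"
  shows "0 < forest_weight w F"
  unfolding forest_weight_def using assms w_pos by (intro prod_pos) auto

text \<open>The forest ratio \<open>y\<close> is feasible and harmonic off the seeds. By
  orthogonality every feasible \<open>x\<close> costs the energy of \<open>y\<close> plus that of
  \<open>x - y\<close>.\<close>

theorem (in weighted_graph) rw_potential_eq_forest_ratio:
  assumes "connected_graph V E" and s: "s1 \<in> V" "s2 \<in> V" "s1 \<noteq> s2" and q: "q \<in> V"
  shows "rw_potential V E w s1 s2 \<alpha> q =
    (\<Sum>F\<in>separating_forests_with V E s1 q s2. forest_weight w F powr \<alpha>) /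
    (\<Sum>F\<in>separating_forests V E s1 s2. forest_weight w F powr \<alpha>)"
proof -
  let ?S = "separating_forests V E s1 s2"
  define c where "c e = w e powr \<alpha>" for e
  have c_pos: "0 < c e" if "e \<in> E" for e using w_pos[OF that] by (simp add: c_def)
  define N where "N x = (\<Sum>F\<in>separating_forests_with V E s1 x s2. prod c F)" for x
  define D where "D = (\<Sum>F\<in>?S. prod c F)"
  \<comment> \<open>The restriction places the candidate in \<open>extensional V\<close>, as
    feasibility demands.\<close>
  define y where "y = restrict (\<lambda>x. N x / D) V"
  have sub: "F \<subseteq> E" if "F \<in> ?S" for F
    using that by (simp add: separating_forests_def spanning_forest_def)
  have "0 < prod c F" if "F \<in> ?S" for F using sub[OF that] c_pos by (intro prod_pos) auto
  then have D: "0 < D"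
    unfolding D_def using separating_forests_nonempty[OF finite_E edges assms(1) s]
    by (intro sum_pos finite_separating_forests finite_E) auto
  have energy: "rw_energy E w \<alpha> = dirichlet E c"
    by (simp add: fun_eq_iff rw_energy_def dirichlet_def c_def)
  have "separating_forests_with V E s1 s1 s2 = ?S" "separating_forests_with V E s1 s2 s2 = {}"
    using s by (auto simp: separating_forests_with_def separating_forests_def conn_rel_def)
  then have y_feas: "y \<in> rw_feasible V s1 s2"
    using s D by (simp add: rw_feasible_def y_def N_def D_def)
  have harm: "(\<Sum>u\<in>V. conductance E c u v * (y v - y u)) = 0" if "v \<in> V" "v \<noteq> s1" "v \<noteq> s2" for v
  proof -
    have "(\<Sum>u\<in>V. conductance E c u v * (y v - y u)) =
        (\<Sum>u\<in>V. conductance E c u v * (N v - N u)) / D"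
      unfolding sum_divide_distrib using that
      by (intro sum.cong) (auto simp: y_def diff_divide_distrib right_diff_distrib)
    then show ?thesis
      using forest_sum_harmonic[OF finite_V finite_E _ s(1,2) that, of c] edges by (simp add: N_def)
  qed
  have split: "dirichlet E c x = dirichlet E c y + dirichlet E c (\<lambda>v. x v - y v)"
    if "x \<in> rw_feasible V s1 s2" for x
  proof -
    \<comment> \<open>The difference \<open>x - y\<close> vanishes at both seeds, so harmonicity at
      the other vertices suffices.\<close>
    have "(\<Sum>u\<in>V. conductance E c u v * (y v - y u)) = 0" if "v \<in> V" "x v - y v \<noteq> 0" for v
      using harm[OF that(1)] that(2) y_feas \<open>x \<in> _\<close>
      by (cases "v = s1 \<or> v = s2") (auto simp: rw_feasible_def)
    then show ?thesis
      using dirichlet_add_orthogonal[OF finite_V edges, of E "\<lambda>v. x v - y v" c y] by simp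
  qed
  have "rw_potential V E w s1 s2 \<alpha> = y"
    unfolding rw_potential_def energy
  proof (rule the_equality)
    show "is_arg_min (dirichlet E c) (\<lambda>x. x \<in> rw_feasible V s1 s2) y"
      unfolding is_arg_min_def
    proof (intro conjI notI y_feas, elim exE conjE)
      fix x assume "x \<in> rw_feasible V s1 s2" "dirichlet E c x < dirichlet E c y"
      then show False
        using split[of x] dirichlet_nonneg[of E c "\<lambda>v. x v - y v"] c_pos edges
        by (force simp: less_imp_le)
    qed
  next
    fix x assume x: "is_arg_min (dirichlet E c) (\<lambda>x. x \<in> rw_feasible V s1 s2) x"
    then have xf: "x \<in> rw_feasible V s1 s2" and "dirichlet E c x \<le> dirichlet E c y"
      using y_feas by (auto simp: is_arg_min_def not_less)
    then have "dirichlet E c (\<lambda>v. x v - y v) \<le> 0" using split[OF xf] by simp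
    moreover have "0 \<le> dirichlet E c (\<lambda>v. x v - y v)"
      using c_pos edges by (intro dirichlet_nonneg) (auto simp: less_imp_le)
    ultimately have z: "dirichlet E c (\<lambda>v. x v - y v) = 0" by simp
    \<comment> \<open>A difference of zero energy is constant on the connected graph, and it is 0 at
      \<open>s1\<close>.\<close>
    have "x v = y v" if "v \<in> V" for v
    proof -
      have "reach E s1 v" using assms(1) s that by (auto simp: connected_graph_def conn_rel_def)
      then have "x s1 - y s1 = x v - y v"
        using dirichlet_zero_reach[OF finite_E c_pos _ z] edges by blast
      then show ?thesis using xf y_feas by (simp add: rw_feasible_def)
    qed
    then show "x = y"
      using xf y_feas by (intro extensionalityI[of _ V]) (auto simp: rw_feasible_def)
  qed
  moreover have "prod c F = forest_weight w F powr \<alpha>" for F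
    by (simp add: c_def forest_weight_def prod_powr_distrib)
  ultimately show ?thesis
    using q by (simp add: y_def N_def D_def)
qed

section \<open>The limit of large exponents\<close>

lemma tendsto_powr_exponent_at_top:
  fixes r :: real
  assumes "0 < r" "r \<le> 1"
  shows "((\<lambda>\<alpha>. r powr \<alpha>) \<longlongrightarrow> (if r = 1 then 1 else 0)) at_top"
proof (cases "r = 1")
  case False
  then have "ln r < 0" using assms by simp
  then have "filterlim (\<lambda>\<alpha>. \<alpha> * ln r) at_bot at_top"
    using filterlim_tendsto_neg_mult_at_bot[OF tendsto_const _ filterlim_ident, of "ln r"]
    by (simp add: mult.commute)
  then have "((\<lambda>\<alpha>. exp (\<alpha> * ln r)) \<longlongrightarrow> 0) at_top"
    by (rule filterlim_compose[OF exp_at_bot])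
  then show ?thesis using False assms by (simp add: powr_def)
qed simp

text \<open>After division every base \<open>g a / m\<close> lies in the interval from 0 to 1, so
  only the terms with base 1 survive. As \<open>m\<close> is merely an upper bound, this also covers
  a family that misses the maximum; its limit is 0.\<close>

lemma tendsto_sum_powr_normalized:
  fixes g :: "'b \<Rightarrow> real"
  assumes "finite A" "0 < m" "\<And>a. a \<in> A \<Longrightarrow> 0 < g a \<and> g a \<le> m"
  shows "((\<lambda>\<alpha>. (\<Sum>a\<in>A. g a powr \<alpha>) / m powr \<alpha>) \<longlongrightarrow> real (card {a \<in> A. g a = m})) at_top"
proof -
  have "((\<lambda>\<alpha>. \<Sum>a\<in>A. (g a / m) powr \<alpha>) \<longlongrightarrow> (\<Sum>a\<in>A. if g a / m = 1 then 1 else 0)) at_top"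
    using assms by (intro tendsto_sum tendsto_powr_exponent_at_top) auto
  moreover have "(\<Sum>a\<in>A. (g a / m) powr \<alpha>) = (\<Sum>a\<in>A. g a powr \<alpha>) / m powr \<alpha>" for \<alpha>
    unfolding sum_divide_distrib using assms by (intro sum.cong) (auto simp: powr_divide less_imp_le)
  moreover have "(\<Sum>a\<in>A. if g a / m = 1 then 1 else 0) = real (card {a \<in> A. g a = m})"
  proof -
    have "g a / m = 1 \<longleftrightarrow> g a = m" for a using assms(2) by auto
    then show ?thesis using assms(1) by (simp only: sum.inter_filter[symmetric]) simp
  qed
  ultimately show ?thesis by simp
qed

text \<open>Convergence is asserted along with the value because \<open>Lim\<close> is a definite
  description, meaningful only when the limit exists.\<close>

theorem theorem5p1:
  fixes V :: "'a set" and E :: "'a set set" and w :: "'a set \<Rightarrow> real" and s1 s2 q :: 'a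
  assumes "weighted_graph V E w"
    and "connected_graph V E"
    and "s1 \<in> V" and "s2 \<in> V" and "s1 \<noteq> s2" and "q \<in> V"
  shows "((\<lambda>\<alpha>. rw_potential V E w s1 s2 \<alpha> q) \<longlongrightarrow> pw_potential V E w s1 s2 q) at_top \<and>
    pw_potential V E w s1 s2 q =
      real (card {f \<in> separating_forests_with V E s1 q s2.
                    forest_weight w f = max_forest_weight V E w s1 s2}) /
      real (card {f \<in> separating_forests V E s1 s2.
                    forest_weight w f = max_forest_weight V E w s1 s2})"
proof -
  interpret weighted_graph V E w by fact
  let ?S = "separating_forests V E s1 s2" and ?Sq = "separating_forests_with V E s1 q s2"
  let ?m = "max_forest_weight V E w s1 s2" and ?W = "forest_weight w"
  let ?L = "real (card {f \<in> ?Sq. ?W f = ?m}) / real (card {f \<in> ?S. ?W f = ?m})"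
  have fin: "finite ?S" using finite_separating_forests[OF finite_E] .
  have ne: "?S \<noteq> {}" using separating_forests_nonempty[OF finite_E edges assms(2-5)] .
  have bounds: "0 < ?W f \<and> ?W f \<le> ?m" if "f \<in> ?S" for f
    using that fin forest_weight_pos
    by (auto simp: max_forest_weight_def separating_forests_def spanning_forest_def)
  have "?m \<in> ?W ` ?S" unfolding max_forest_weight_def using fin ne by (intro Max_in) auto
  then obtain f0 where f0: "f0 \<in> ?S" "?W f0 = ?m" by auto
  then have m: "0 < ?m" using bounds by metis
  have "{f \<in> ?S. ?W f = ?m} \<noteq> {}" using f0 by blast
  then have card_ne: "real (card {f \<in> ?S. ?W f = ?m}) \<noteq> 0" using fin by simp
  have sub: "?Sq \<subseteq> ?S" by (auto simp: separating_forests_with_def)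
  \<comment> \<open>Numerator and denominator are scaled by the same positive power of
    \<open>?m\<close>, which cancels in the ratio; the limit of the denominator is nonzero because
    the maximum is attained.\<close>
  have "((\<lambda>\<alpha>. ((\<Sum>f\<in>?Sq. ?W f powr \<alpha>) / ?m powr \<alpha>) /
      ((\<Sum>f\<in>?S. ?W f powr \<alpha>) / ?m powr \<alpha>)) \<longlongrightarrow> ?L) at_top"
    using bounds sub finite_subset[OF sub fin] fin m card_ne
    by (intro tendsto_divide tendsto_sum_powr_normalized) auto
  then have lim: "((\<lambda>\<alpha>. rw_potential V E w s1 s2 \<alpha> q) \<longlongrightarrow> ?L) at_top"
    using m by (simp add: rw_potential_eq_forest_ratio[OF assms(2-6)])
  then have "pw_potential V E w s1 s2 q = ?L"
    unfolding pw_potential_def by (intro tendsto_Lim) auto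
  with lim show ?thesis by simp
qed

end
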